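(* Let $A=(a_{ij})\in\mathbb{M}(n)$ be nonnegative. Let $x_{ij}=\min\{a_{ij},a_{ji}\}$ for all $i$ and $j$, and let $X=(x_{ij})\in\mathbb{M}(n)$. Then, for any positive unital linear map $\Phi:\mathbb{M}(n)\to\mathbb{M}(k)$, $$\rho(A)\,I_k\ \ge\ \Phi(X).$$
   Context: $\mathbb{M}(n)$ is the algebra of all $n\times n$ complex matrices and $I_k$ is the $k\times k$ identity matrix. A matrix $A=(a_{ij})$ is nonnegative if $a_{ij}\ge0$ for all $i,j$ (entrywise); $A$ is not assumed symmetric. $\rho(A)=\max\{|\lambda|:\lambda\in\sigma(A)\}$ is the spectral radius, where $\sigma(A)$ is the spectrum of $A$. A linear map $\Phi:\mathbb{M}(n)\to\mathbb{M}(k)$ is positive if $\Phi(M)$ is positive semidefinite whenever $M$ is positive semidefinite, and unital if $\Phi(I_n)=I_k$. For Hermitian $k\times k$ matrices, $P\ge Q$ means that $P-Q$ is positive semidefinite. *)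

theory Defs
  imports
    "Jordan_Normal_Form.Spectral_Radius"
    "Jordan_Normal_Form.VS_Connect"
begin

text \<open>Here \<open>\<le>\<close> on \<^typ>\<open>complex\<close> is the order of Complex_Order: \<open>0 \<le> z\<close> says that
  \<open>z\<close> is real and nonnegative.\<close>

definition nonnegative_mat :: "complex mat \<Rightarrow> bool" where
  "nonnegative_mat A \<longleftrightarrow> (\<forall>i < dim_row A. \<forall>j < dim_col A. 0 \<le> A $$ (i, j))"

text \<open>Intended for nonnegative \<open>A\<close>, whose entries are equal to their real parts.\<close>

definition sym_min_mat :: "nat \<Rightarrow> complex mat \<Rightarrow> complex mat" where
  "sym_min_mat n A =
     mat n n (\<lambda>(i, j). complex_of_real (min (Re (A $$ (i, j))) (Re (A $$ (j, i)))))"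

definition hermitian_mat :: "nat \<Rightarrow> complex mat \<Rightarrow> bool" where
  "hermitian_mat n M \<longleftrightarrow> M \<in> carrier_mat n n \<and> mat_adjoint M = M"

definition psd_mat :: "nat \<Rightarrow> complex mat \<Rightarrow> bool" where
  "psd_mat n M \<longleftrightarrow> hermitian_mat n M \<and> (\<forall>v \<in> carrier_vec n. 0 \<le> (M *\<^sub>v v) \<bullet>c v)"

definition loewner_ge :: "nat \<Rightarrow> complex mat \<Rightarrow> complex mat \<Rightarrow> bool" where
  "loewner_ge k P Q \<longleftrightarrow> hermitian_mat k P \<and> hermitian_mat k Q \<and> psd_mat k (P - Q)"

definition linear_mat_map :: "nat \<Rightarrow> nat \<Rightarrow> (complex mat \<Rightarrow> complex mat) \<Rightarrow> bool" where
  "linear_mat_map n k \<Phi> \<longleftrightarrow>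
     linear_map class_ring (module_mat TYPE(complex) n n) (module_mat TYPE(complex) k k) \<Phi>"

definition positive_mat_map :: "nat \<Rightarrow> nat \<Rightarrow> (complex mat \<Rightarrow> complex mat) \<Rightarrow> bool" where
  "positive_mat_map n k \<Phi> \<longleftrightarrow> (\<forall>M. psd_mat n M \<longrightarrow> psd_mat k (\<Phi> M))"

definition unital_mat_map :: "nat \<Rightarrow> nat \<Rightarrow> (complex mat \<Rightarrow> complex mat) \<Rightarrow> bool" where
  "unital_mat_map n k \<Phi> \<longleftrightarrow> \<Phi> (1\<^sub>m n) = 1\<^sub>m k"

lemma vectorspace_module_mat:
  "vectorspace class_ring (module_mat TYPE(complex) nr nc)"
proof -
  interpret M: abelian_group "module_mat TYPE(complex) nr nc"
    by (rule abelian_group_mat)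
  interpret K: field "class_ring :: complex ring" by (rule class_field)
  show ?thesis
    by unfold_locales
      (auto simp: module_mat_simps class_ring_simps add_smult_distrib_right_mat
        add_smult_distrib_left_mat intro!: eq_matI)
qed

lemma linear_mat_map_iff:
  "linear_mat_map n k \<Phi> \<longleftrightarrow>
     (\<forall>M \<in> carrier_mat n n. \<Phi> M \<in> carrier_mat k k) \<and>
     (\<forall>M \<in> carrier_mat n n. \<forall>N \<in> carrier_mat n n. \<Phi> (M + N) = \<Phi> M + \<Phi> N) \<and>
     (\<forall>c. \<forall>M \<in> carrier_mat n n. \<Phi> (c \<cdot>\<^sub>m M) = c \<cdot>\<^sub>m \<Phi> M)"
proof -
  have m: "Module.module class_ring (module_mat TYPE(complex) r c)" for r c
    using vectorspace_module_mat[of r c] by (simp add: vectorspace_def)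
  show ?thesis
    unfolding linear_mat_map_def linear_map_def mod_hom_def mod_hom_axioms_def module_hom_def
    by (auto simp: vectorspace_module_mat m module_mat_simps class_ring_simps)
qed

end

theory Submission
  imports Defs "HOL-Analysis.Convex"
begin

text \<open>
  A positive unital map preserves the order of Hermitian matrices and sends \<open>r I\<^sub>n\<close> to \<open>r I\<^sub>k\<close>, so it
  suffices that \<open>\<rho>(A) I\<^sub>n \<ge> X\<close>, where \<open>X\<close> is the entrywise minimum of \<open>A\<close> and its transpose
  (lemma \<open>positive_unital_map_loewner_scalar\<close>). As \<open>X\<close> has nonnegative entries, replacing the
  entries of a complex vector by their absolute values does not decrease its quadratic form.
  It remains to bound the Rayleigh quotient
  \<open>q = (w \<bullet> X w) / (w \<bullet> w)\<close> by \<open>\<rho>(A)\<close> for real vectors \<open>w\<close> with nonnegative entries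
  (lemma \<open>symmetric_quadratic_form_le_spectral_radius\<close>).

  This is done by comparing the growth of powers, with no appeal to Perron--Frobenius theory or to
  the diagonalisation of \<open>X\<close>. By symmetry \<open>w \<bullet> X\<^sup>2\<^sup>k w\<close> is the square of the length of \<open>X\<^sup>k w\<close>, so
  Cauchy--Schwarz bounds the square of \<open>w \<bullet> X\<^sup>k w\<close> by \<open>(w \<bullet> w) (w \<bullet> X\<^sup>2\<^sup>k w)\<close>. Iterating over the
  exponents \<open>N = 1, 2, 4, 8, \<dots>\<close> gives \<open>q\<^sup>N \<le> (w \<bullet> X\<^sup>N w) / (w \<bullet> w)\<close>. Since \<open>0 \<le> X \<le> A\<close> entrywise,
  the entries of \<open>X\<^sup>N\<close> are at most those of \<open>A\<^sup>N\<close>, and these are \<open>O(c\<^sup>N)\<close> for each \<open>c > \<rho>(A)\<close>. If \<open>q\<close>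
  exceeded \<open>\<rho>(A)\<close>, a \<open>c\<close> strictly between them would make the unbounded sequence \<open>(q / c)\<^sup>N\<close>
  bounded.
\<close>

unbundle no inner_syntax

section \<open>Powers of a symmetric matrix\<close>

lemma pow_mat_add:
  fixes A :: "'a :: semiring_1 mat"
  assumes A: "A \<in> carrier_mat n n"
  shows "A ^\<^sub>m (k + l) = A ^\<^sub>m k * A ^\<^sub>m l"
proof (induction l)
  case 0
  then show ?case using A by simp
next
  case (Suc l)
  then show ?case
    using assoc_mult_mat[OF pow_carrier_mat[OF A] pow_carrier_mat[OF A] A] by simp
qed

lemma transpose_pow_mat:
  fixes A :: "'a :: comm_semiring_1 mat"
  assumes A: "A \<in> carrier_mat n n"
  shows "(A ^\<^sub>m k)\<^sup>T = A\<^sup>T ^\<^sub>m k"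
proof (induction k)
  case 0
  then show ?case using A by simp
next
  case (Suc k)
  have "(A ^\<^sub>m Suc k)\<^sup>T = A\<^sup>T * A\<^sup>T ^\<^sub>m k"
    using transpose_mult[OF pow_carrier_mat[OF A] A, of k] Suc by simp
  also have "\<dots> = A\<^sup>T ^\<^sub>m Suc k"
    using pow_mat_add[of "A\<^sup>T" n 1 k] pow_mat_add[of "A\<^sup>T" n k 1] A by simp
  finally show ?case .
qed

lemma Cauchy_Schwarz_scalar_prod:
  fixes v w :: "real vec"
  assumes "v \<in> carrier_vec n" "w \<in> carrier_vec n"
  shows "(v \<bullet> w)\<^sup>2 \<le> (v \<bullet> v) * (w \<bullet> w)"
  using assms Cauchy_Schwarz_ineq_sum[of "\<lambda>i. v $ i" "\<lambda>i. w $ i" "{0..<n}"]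
  by (simp add: scalar_prod_def power2_eq_square)

text \<open>Moving half of the factors of \<open>X\<^sup>2\<^sup>k\<close> to the other side of the scalar product turns the right-hand
  form into the squared length of \<open>X\<^sup>k w\<close>; what remains is Cauchy--Schwarz for \<open>w\<close> and \<open>X\<^sup>k w\<close>.\<close>

lemma symmetric_pow_quadratic_form_double:
  fixes X :: "real mat"
  assumes X: "X \<in> carrier_mat n n" and sym: "X\<^sup>T = X" and w: "w \<in> carrier_vec n"
  shows "(w \<bullet> (X ^\<^sub>m k *\<^sub>v w))\<^sup>2 \<le> (w \<bullet> w) * (w \<bullet> (X ^\<^sub>m (2 * k) *\<^sub>v w))"
proof -
  note Xk = pow_carrier_mat[OF X, of k]
  have u: "X ^\<^sub>m k *\<^sub>v w \<in> carrier_vec n" using Xk w by simp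
  have "w \<bullet> (X ^\<^sub>m (2 * k) *\<^sub>v w) = w \<bullet> (X ^\<^sub>m k *\<^sub>v (X ^\<^sub>m k *\<^sub>v w))"
    using pow_mat_add[OF X, of k k] Xk w by (simp add: mult_2)
  also have "\<dots> = (X ^\<^sub>m k *\<^sub>v w) \<bullet> (X ^\<^sub>m k *\<^sub>v w)"
    using transpose_vec_mult_scalar[OF Xk u w] transpose_pow_mat[OF X, of k] sym by simp
  finally show ?thesis
    using Cauchy_Schwarz_scalar_prod[OF w u] by simp
qed

text \<open>Each doubling of the exponent squares the lower bound. Exponents that are powers of two are
  enough to compare exponential growth rates, and they spare a spectral decomposition of \<open>X\<close>.\<close>

lemma symmetric_quadratic_form_power_le:
  fixes X :: "real mat"
  assumes X: "X \<in> carrier_mat n n" and sym: "X\<^sup>T = X" and w: "w \<in> carrier_vec n"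
    and pos: "0 < w \<bullet> w" and nonneg: "0 \<le> w \<bullet> (X *\<^sub>v w)"
  shows "(w \<bullet> (X *\<^sub>v w) / (w \<bullet> w)) ^ (2 ^ m) \<le> w \<bullet> (X ^\<^sub>m (2 ^ m) *\<^sub>v w) / (w \<bullet> w)"
proof (induction m)
  case 0
  then show ?case using X by simp
next
  case (Suc m)
  let ?q = "\<lambda>k. w \<bullet> (X ^\<^sub>m k *\<^sub>v w) / (w \<bullet> w)"
  let ?r = "w \<bullet> (X *\<^sub>v w) / (w \<bullet> w)"
  have "?r ^ (2 ^ Suc m) = (?r ^ (2 ^ m))\<^sup>2"
    by (metis power_Suc2 power_mult)
  also have "\<dots> \<le> (?q (2 ^ m))\<^sup>2"
    using Suc.IH pos nonneg by (intro power_mono) auto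
  also have "\<dots> \<le> ?q (2 ^ Suc m)"
    using symmetric_pow_quadratic_form_double[OF X sym w, of "2 ^ m"] pos
    by (simp add: divide_simps power2_eq_square mult.commute)
  finally show ?case .
qed

section \<open>Entrywise estimates\<close>

lemma pow_mat_entry_mono:
  fixes X B :: "real mat"
  assumes X: "X \<in> carrier_mat n n" and B: "B \<in> carrier_mat n n"
    and nonneg: "\<And>i j. i < n \<Longrightarrow> j < n \<Longrightarrow> 0 \<le> X $$ (i, j)"
    and le: "\<And>i j. i < n \<Longrightarrow> j < n \<Longrightarrow> X $$ (i, j) \<le> B $$ (i, j)"
    and "i < n" "j < n"
  shows "0 \<le> (X ^\<^sub>m k) $$ (i, j) \<and> (X ^\<^sub>m k) $$ (i, j) \<le> (B ^\<^sub>m k) $$ (i, j)"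
  using \<open>i < n\<close> \<open>j < n\<close>
proof (induction k arbitrary: i j)
  case 0
  then show ?case using X B by simp
next
  case (Suc k)
  have entry: "(C ^\<^sub>m Suc k) $$ (i, j) = (\<Sum>l = 0..<n. (C ^\<^sub>m k) $$ (i, l) * C $$ (l, j))"
    if "C \<in> carrier_mat n n" for C :: "real mat"
    using that pow_carrier_mat[OF that, of k] Suc.prems by (simp add: scalar_prod_def)
  show ?case
    unfolding entry[OF X] entry[OF B] using Suc nonneg le
    by (intro conjI sum_nonneg sum_mono mult_mono mult_nonneg_nonneg)
       (auto intro: order_trans)
qed

lemma quadratic_form_sum:
  fixes M :: "'a :: comm_semiring_0 mat"
  assumes "M \<in> carrier_mat n n" "v \<in> carrier_vec n" "w \<in> carrier_vec n"
  shows "w \<bullet> (M *\<^sub>v v) = (\<Sum>i = 0..<n. \<Sum>j = 0..<n. M $$ (i, j) * (w $ i * v $ j))"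
  using assms by (simp add: scalar_prod_def sum_distrib_left ac_simps)

lemma smult_mat_mult_vec:
  fixes A :: "'a :: comm_semiring_0 mat"
  assumes A: "A \<in> carrier_mat nr n" and v: "v \<in> carrier_vec n"
  shows "(c \<cdot>\<^sub>m A) *\<^sub>v v = c \<cdot>\<^sub>v (A *\<^sub>v v)"
proof (rule eq_vecI)
  fix i assume "i < dim_vec (c \<cdot>\<^sub>v (A *\<^sub>v v))"
  then show "((c \<cdot>\<^sub>m A) *\<^sub>v v) $ i = (c \<cdot>\<^sub>v (A *\<^sub>v v)) $ i"
    using A v smult_scalar_prod_distrib[of "row A i" n v c] by simp
qed (use A in simp)

section \<open>Growth of the powers and the spectral radius\<close>

text \<open>The spectral radius controls growth from above: \<open>A / c\<close> has spectral radius below one, so its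
  powers are bounded by the Jordan normal form, and multiplying back restores the factor \<open>c\<^sup>k\<close>.\<close>

lemma spectral_radius_power_bound:
  assumes A: "A \<in> carrier_mat n n" and n: "0 < n" and c: "spectral_radius A < c"
  obtains b where "\<And>k i j. i < n \<Longrightarrow> j < n \<Longrightarrow> norm ((A ^\<^sub>m k) $$ (i, j)) \<le> b * c ^ k"
proof -
  have c0: "0 < c"
    using spectral_radius_mem_max(1)[OF A n] c by (smt (verit) imageE norm_ge_zero)
  let ?d = "complex_of_real c"
  define B where "B = inverse ?d \<cdot>\<^sub>m A"
  have B: "B \<in> carrier_mat n n" using A by (simp add: B_def)
  have AB: "A = ?d \<cdot>\<^sub>m B" using c0 by (intro eq_matI) (auto simp: B_def)
  have "spectral_radius B < 1"
  proof -
    obtain e where e: "e \<in> spectrum B" and sr: "spectral_radius B = norm e"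
      using spectral_radius_mem_max(1)[OF B n] by auto
    then obtain v where v: "v \<in> carrier_vec n" "v \<noteq> 0\<^sub>v n" "B *\<^sub>v v = e \<cdot>\<^sub>v v"
      using B by (auto simp: spectrum_def eigenvalue_def eigenvector_def)
    have "A *\<^sub>v v = ?d \<cdot>\<^sub>v (B *\<^sub>v v)"
      unfolding AB by (rule smult_mat_mult_vec[OF B v(1)])
    then have "eigenvector A v (?d * e)"
      using v A by (simp add: eigenvector_def smult_smult_assoc)
    then have "norm (?d * e) \<le> spectral_radius A"
      by (intro spectral_radius_mem_max(2)[OF A n]) (auto simp: spectrum_def eigenvalue_def intro!: imageI)
    then show ?thesis using c c0 sr by (simp add: norm_mult) (smt (verit) mult_le_cancel_left1)
  qed
  then obtain b where b: "\<And>k. norm_bound (B ^\<^sub>m k) b"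
    using spectral_radius_jnf_norm_bound_less_1_upper_triangular[OF B] by auto
  have pow: "A ^\<^sub>m k = ?d ^ k \<cdot>\<^sub>m B ^\<^sub>m k" for k
  proof (induction k)
    case 0
    then show ?case using A B by (intro eq_matI) auto
  next
    case (Suc k)
    have "A ^\<^sub>m Suc k = (?d ^ k \<cdot>\<^sub>m B ^\<^sub>m k) * (?d \<cdot>\<^sub>m B)" using Suc AB by simp
    also have "\<dots> = ?d ^ Suc k \<cdot>\<^sub>m (B ^\<^sub>m k * B)"
      using pow_carrier_mat[OF B, of k] B
      by (intro eq_matI) (auto simp: scalar_prod_def sum_distrib_left ac_simps)
    finally show ?case by simp
  qed
  show thesis
  proof (rule that)
    fix k i j
    assume "i < n" "j < n"
    then have "norm ((B ^\<^sub>m k) $$ (i, j)) \<le> b"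
      using b[of k] B by (auto simp: norm_bound_def)
    then show "norm ((A ^\<^sub>m k) $$ (i, j)) \<le> b * c ^ k"
      unfolding pow using \<open>i < n\<close> \<open>j < n\<close> B pow_carrier_mat[OF B, of k] c0
      by (simp add: norm_mult norm_power mult.commute)
  qed
qed

text \<open>The quadratic form of \<open>X\<^sup>N\<close> grows at least like \<open>q\<^sup>N\<close>, where \<open>q\<close> is the Rayleigh quotient, but
  it is dominated by that of \<open>A\<^sup>N\<close>, which grows no faster than \<open>c\<^sup>N\<close> for any \<open>c\<close> above the spectral
  radius. Domination needs \<open>w\<close> to be nonnegative. The order on complex numbers forces the entries
  of \<open>A\<close> to be real, so the powers can be compared over the reals.\<close>

lemma symmetric_quadratic_form_le_spectral_radius:
  fixes X :: "real mat" and A :: "complex mat"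
  assumes A: "A \<in> carrier_mat n n" and n: "0 < n"
    and X: "X \<in> carrier_mat n n" and sym: "X\<^sup>T = X"
    and nonneg: "\<And>i j. i < n \<Longrightarrow> j < n \<Longrightarrow> 0 \<le> X $$ (i, j)"
    and le: "\<And>i j. i < n \<Longrightarrow> j < n \<Longrightarrow> complex_of_real (X $$ (i, j)) \<le> A $$ (i, j)"
    and w: "w \<in> carrier_vec n" and w0: "\<And>i. i < n \<Longrightarrow> 0 \<le> w $ i"
  shows "w \<bullet> (X *\<^sub>v w) \<le> spectral_radius A * (w \<bullet> w)"
proof (cases "w \<bullet> w = 0")
  case True
  then have "w $ i = 0" if "i < n" for i
    using that w by (simp add: scalar_prod_def sum_nonneg_eq_0_iff)
  then show ?thesis
    using True quadratic_form_sum[OF X w w] by simp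
next
  case False
  then have pos: "0 < w \<bullet> w"
    using w by (simp add: scalar_prod_def order.not_eq_order_implies_strict sum_nonneg)
  define B where "B = map_mat Re A"
  have B: "B \<in> carrier_mat n n" using A by (simp add: B_def)
  have AB: "A = map_mat complex_of_real B"
  proof (rule eq_matI)
    fix i j assume "i < dim_row (map_mat complex_of_real B)" "j < dim_col (map_mat complex_of_real B)"
    then have ij: "i < n" "j < n" using B by auto
    show "A $$ (i, j) = map_mat complex_of_real B $$ (i, j)"
      using le[OF ij] ij A by (auto simp: B_def less_eq_complex_def complex_eq_iff)
  qed (use A B in auto)
  have XB: "X $$ (i, j) \<le> B $$ (i, j)" if "i < n" "j < n" for i j
    using le[OF that] that A by (simp add: B_def less_eq_complex_def)
  let ?q = "w \<bullet> (X *\<^sub>v w) / (w \<bullet> w)"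
  have q0: "0 \<le> w \<bullet> (X *\<^sub>v w)"
    unfolding quadratic_form_sum[OF X w w] using nonneg w0
    by (intro sum_nonneg mult_nonneg_nonneg) auto
  have "?q \<le> spectral_radius A"
  proof (rule ccontr)
    assume "\<not> ?q \<le> spectral_radius A"
    then obtain c where c: "spectral_radius A < c" "c < ?q"
      using dense by (meson not_le)
    have c0: "0 < c"
      using spectral_radius_mem_max(1)[OF A n] c(1) by (smt (verit) imageE norm_ge_zero)
    obtain b where b: "\<And>k i j. i < n \<Longrightarrow> j < n \<Longrightarrow> norm ((A ^\<^sub>m k) $$ (i, j)) \<le> b * c ^ k"
      using spectral_radius_power_bound[OF A n c(1)] by blast
    \<comment> \<open>the constant that results from replacing each entry of \<open>X\<^sup>N\<close> by its bound \<open>b c\<^sup>N\<close>\<close>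
    define K where "K = b * (\<Sum>i = 0..<n. \<Sum>j = 0..<n. w $ i * w $ j) / (w \<bullet> w)"
    have bound: "(?q / c) ^ (2 ^ m) \<le> K" for m
    proof -
      let ?N = "2 ^ m :: nat"
      have Xb: "(X ^\<^sub>m ?N) $$ (i, j) \<le> b * c ^ ?N" if ij: "i < n" "j < n" for i j
      proof -
        have "(X ^\<^sub>m ?N) $$ (i, j) \<le> (B ^\<^sub>m ?N) $$ (i, j)"
          using pow_mat_entry_mono[OF X B nonneg XB ij] by blast
        also have "\<dots> \<le> norm ((A ^\<^sub>m ?N) $$ (i, j))"
          unfolding AB of_real_hom.mat_hom_pow[OF B, symmetric]
          using B ij by (simp add: abs_ge_self)
        finally show ?thesis using b[OF ij, of ?N] by linarith
      qed
      have "?q ^ ?N \<le> w \<bullet> (X ^\<^sub>m ?N *\<^sub>v w) / (w \<bullet> w)"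
        by (rule symmetric_quadratic_form_power_le[OF X sym w pos q0])
      also have "\<dots> \<le> (\<Sum>i = 0..<n. \<Sum>j = 0..<n. b * c ^ ?N * (w $ i * w $ j)) / (w \<bullet> w)"
        unfolding quadratic_form_sum[OF pow_carrier_mat[OF X] w w] using Xb w0 pos
        by (intro divide_right_mono sum_mono mult_right_mono) auto
      also have "\<dots> = K * c ^ ?N"
        unfolding K_def sum_distrib_left[symmetric] by simp
      finally show ?thesis
        using c0 unfolding power_divide[of ?q c] by (simp only: pos_divide_le_eq zero_less_power)
    qed
    have "1 < ?q / c" using c(2) c0 by (simp only: less_divide_eq_1_pos)
    then obtain N where N: "K < (?q / c) ^ N" using real_arch_pow by blast
    \<comment> \<open>only exponents \<open>2\<^sup>m\<close> are covered by \<open>bound\<close>, hence the passage from \<open>N\<close> to \<open>2\<^sup>N \<ge> N\<close>\<close>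
    also have "\<dots> \<le> (?q / c) ^ (2 ^ N)"
      using \<open>1 < ?q / c\<close> less_exp[of N] by (intro power_increasing) auto
    finally show False using bound[of N] by linarith
  qed
  then show ?thesis using pos by (simp add: divide_simps)
qed

section \<open>The order of Hermitian matrices\<close>

lemma mat_adjoint_index [simp]:
  "i < dim_col A \<Longrightarrow> j < dim_row A \<Longrightarrow> mat_adjoint A $$ (i, j) = conjugate (A $$ (j, i))"
  by (simp add: mat_adjoint_def mat_of_rows_def)

lemma mat_adjoint_dim [simp]:
  "dim_row (mat_adjoint A) = dim_col A" "dim_col (mat_adjoint A) = dim_row A"
  by (simp_all add: mat_adjoint_def)

lemma hermitian_mat_iff:
  "hermitian_mat n M \<longleftrightarrow>
     M \<in> carrier_mat n n \<and> (\<forall>i<n. \<forall>j<n. cnj (M $$ (j, i)) = M $$ (i, j))"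
  by (auto simp: hermitian_mat_def mat_eq_iff)

lemma hermitian_mat_minus:
  "hermitian_mat n M \<Longrightarrow> hermitian_mat n N \<Longrightarrow> hermitian_mat n (M - N)"
  by (auto simp: hermitian_mat_iff)

lemma hermitian_mat_of_real_smult_one: "hermitian_mat n (complex_of_real c \<cdot>\<^sub>m 1\<^sub>m n)"
  by (auto simp: hermitian_mat_iff)

lemma conjugate_form_sum:
  fixes M :: "complex mat"
  assumes M: "M \<in> carrier_mat n n" and v: "v \<in> carrier_vec n"
  shows "(M *\<^sub>v v) \<bullet>c v = (\<Sum>i = 0..<n. \<Sum>j = 0..<n. M $$ (i, j) * (cnj (v $ i) * v $ j))"
proof -
  have "(M *\<^sub>v v) \<bullet>c v = conjugate v \<bullet> (M *\<^sub>v v)"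
    using M v by (intro comm_scalar_prod[of _ n]) auto
  also have "\<dots> = (\<Sum>i = 0..<n. \<Sum>j = 0..<n. M $$ (i, j) * (cnj (v $ i) * v $ j))"
    using quadratic_form_sum[OF M v, of "conjugate v"] v by simp
  finally show ?thesis .
qed

text \<open>The complex order \<open>0 \<le> z\<close> includes that \<open>z\<close> is real, which is why positivity of a form needs this
  besides an estimate of its real part.\<close>

lemma hermitian_form_real:
  assumes M: "hermitian_mat n M" and v: "v \<in> carrier_vec n"
  shows "Im ((M *\<^sub>v v) \<bullet>c v) = 0"
proof -
  have Mc: "M \<in> carrier_mat n n" and herm: "\<And>i j. i < n \<Longrightarrow> j < n \<Longrightarrow> cnj (M $$ (i, j)) = M $$ (j, i)"
    using M by (auto simp: hermitian_mat_iff)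
  have "cnj ((M *\<^sub>v v) \<bullet>c v) =
      (\<Sum>i = 0..<n. \<Sum>j = 0..<n. M $$ (j, i) * (cnj (v $ j) * v $ i))"
    unfolding conjugate_form_sum[OF Mc v] by (simp add: herm mult.commute)
  also have "\<dots> = (M *\<^sub>v v) \<bullet>c v"
    unfolding conjugate_form_sum[OF Mc v] by (rule sum.swap)
  finally show ?thesis by (simp add: complex_eq_iff)
qed

text \<open>The step from nonnegative test vectors to all complex ones: if \<open>w\<close> has the entries \<open>\<bar>v\<^sub>i\<bar>\<close>, then
  the form of \<open>X\<close> at \<open>v\<close> is at most its form at \<open>w\<close>, by the triangle inequality and \<open>X \<ge> 0\<close>, while
  \<open>v\<close> and \<open>w\<close> have the same length.\<close>

lemma nonneg_symmetric_loewner_scalar: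
  fixes X :: "real mat"
  assumes X: "X \<in> carrier_mat n n" and sym: "X\<^sup>T = X"
    and nonneg: "\<And>i j. i < n \<Longrightarrow> j < n \<Longrightarrow> 0 \<le> X $$ (i, j)"
    and le: "\<And>w. w \<in> carrier_vec n \<Longrightarrow> (\<And>i. i < n \<Longrightarrow> 0 \<le> w $ i) \<Longrightarrow>
               w \<bullet> (X *\<^sub>v w) \<le> r * (w \<bullet> w)"
  shows "loewner_ge n (complex_of_real r \<cdot>\<^sub>m 1\<^sub>m n) (map_mat complex_of_real X)"
proof -
  let ?r = "complex_of_real r" and ?X = "map_mat complex_of_real X"
  have Xc: "?X \<in> carrier_mat n n" using X by simp
  have "X $$ (j, i) = X $$ (i, j)" if "i < n" "j < n" for i j
    using arg_cong[OF sym, of "\<lambda>M. M $$ (i, j)"] X that by simp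
  then have hX: "hermitian_mat n ?X"
    using X by (auto simp: hermitian_mat_iff)
  note hr = hermitian_mat_of_real_smult_one[of n r]
  note hD = hermitian_mat_minus[OF hr hX]
  have "0 \<le> ((?r \<cdot>\<^sub>m 1\<^sub>m n - ?X) *\<^sub>v v) \<bullet>c v" if v: "v \<in> carrier_vec n" for v
  proof -
    define w where "w = map_vec norm v"
    have w: "w \<in> carrier_vec n" and w0: "\<And>i. i < n \<Longrightarrow> 0 \<le> w $ i"
      using v by (auto simp: w_def)
    have "Re ((?X *\<^sub>v v) \<bullet>c v) = (\<Sum>i = 0..<n. \<Sum>j = 0..<n. X $$ (i, j) * Re (cnj (v $ i) * v $ j))"
      unfolding conjugate_form_sum[OF Xc v] using X by simp
    also have "\<dots> \<le> (\<Sum>i = 0..<n. \<Sum>j = 0..<n. X $$ (i, j) * (w $ i * w $ j))"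
    proof (intro sum_mono mult_left_mono)
      fix i j assume ij: "i \<in> {0..<n}" "j \<in> {0..<n}"
      have "Re (cnj (v $ i) * v $ j) \<le> norm (cnj (v $ i) * v $ j)" by (rule complex_Re_le_cmod)
      then show "Re (cnj (v $ i) * v $ j) \<le> w $ i * w $ j"
        using ij v by (simp add: w_def norm_mult)
    qed (use nonneg in auto)
    also have "\<dots> = w \<bullet> (X *\<^sub>v w)" by (rule quadratic_form_sum[OF X w w, symmetric])
    also have "\<dots> \<le> r * (w \<bullet> w)" by (rule le[OF w w0])
    also have "w \<bullet> w = Re (v \<bullet>c v)"
      using v by (simp add: w_def scalar_prod_def complex_norm_square[symmetric] power2_eq_square
          flip: of_real_mult)
    finally have X_le: "Re ((?X *\<^sub>v v) \<bullet>c v) \<le> r * Re (v \<bullet>c v)" .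
    have "(?r \<cdot>\<^sub>m 1\<^sub>m n - ?X) *\<^sub>v v = ?r \<cdot>\<^sub>v v - ?X *\<^sub>v v"
      using minus_mult_distrib_mat_vec[OF _ Xc v, of "?r \<cdot>\<^sub>m 1\<^sub>m n"] v
      by (simp add: smult_mat_mult_vec[of _ n n])
    then have "((?r \<cdot>\<^sub>m 1\<^sub>m n - ?X) *\<^sub>v v) \<bullet>c v = ?r * (v \<bullet>c v) - (?X *\<^sub>v v) \<bullet>c v"
      using v Xc by (simp add: minus_scalar_prod_distrib[of _ n])
    then have "0 \<le> Re (((?r \<cdot>\<^sub>m 1\<^sub>m n - ?X) *\<^sub>v v) \<bullet>c v)"
      using X_le by simp
    then show ?thesis
      using hermitian_form_real[OF hD v] by (simp add: less_eq_complex_def)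
  qed
  then show ?thesis
    using hr hX hD by (simp add: loewner_ge_def psd_mat_def)
qed

text \<open>Apply \<open>\<Phi>\<close> to the positive semidefinite matrix \<open>r I - M\<close>. That \<open>\<Phi> M\<close> is Hermitian follows too,
  as it is the difference of \<open>r I\<close> and this image.\<close>

lemma positive_unital_map_loewner_scalar:
  assumes lin: "linear_mat_map n k \<Phi>" and pos: "positive_mat_map n k \<Phi>"
    and unital: "unital_mat_map n k \<Phi>"
    and ge: "loewner_ge n (complex_of_real r \<cdot>\<^sub>m 1\<^sub>m n) M"
  shows "loewner_ge k (complex_of_real r \<cdot>\<^sub>m 1\<^sub>m k) (\<Phi> M)"
proof -
  let ?r = "complex_of_real r"
  let ?D = "?r \<cdot>\<^sub>m 1\<^sub>m n - M"
  have M: "M \<in> carrier_mat n n" and D: "psd_mat n ?D"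
    using ge by (auto simp: loewner_ge_def hermitian_mat_def)
  have Dc: "?D \<in> carrier_mat n n" using M by (rule minus_carrier_mat)
  have \<Phi>D: "psd_mat k (\<Phi> ?D)" using pos D by (simp add: positive_mat_map_def)
  have \<Phi>M: "\<Phi> M \<in> carrier_mat k k" using lin M by (simp add: linear_mat_map_iff)
  have "?r \<cdot>\<^sub>m 1\<^sub>m n = ?D + M" using M by (intro eq_matI) auto
  then have "?r \<cdot>\<^sub>m 1\<^sub>m k = \<Phi> ?D + \<Phi> M"
    using lin unital M Dc unfolding linear_mat_map_iff unital_mat_map_def
    by (metis one_carrier_mat)
  then have diff: "?r \<cdot>\<^sub>m 1\<^sub>m k - \<Phi> M = \<Phi> ?D" and "\<Phi> M = ?r \<cdot>\<^sub>m 1\<^sub>m k - \<Phi> ?D"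
    using \<Phi>M \<Phi>D by (auto simp: psd_mat_def hermitian_mat_def intro!: eq_matI)
  then have "hermitian_mat k (\<Phi> M)"
    using \<Phi>D hermitian_mat_minus[OF hermitian_mat_of_real_smult_one, of k "\<Phi> ?D" r]
    by (simp add: psd_mat_def)
  then show ?thesis
    using diff \<Phi>D hermitian_mat_of_real_smult_one by (simp add: loewner_ge_def)
qed

theorem corollary2p3:
  fixes n k :: nat and A :: "complex mat" and \<Phi> :: "complex mat \<Rightarrow> complex mat"
  assumes "0 < n"
    and "A \<in> carrier_mat n n"
    and "nonnegative_mat A"
    and "linear_mat_map n k \<Phi>"
    and "positive_mat_map n k \<Phi>"
    and "unital_mat_map n k \<Phi>"
  shows "loewner_ge k (complex_of_real (spectral_radius A) \<cdot>\<^sub>m 1\<^sub>m k) (\<Phi> (sym_min_mat n A))"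
proof -
  define X where "X = mat n n (\<lambda>(i, j). min (Re (A $$ (i, j))) (Re (A $$ (j, i))))"
  have X: "X \<in> carrier_mat n n" and sym: "X\<^sup>T = X"
    by (auto simp: X_def min.commute)
  have A0: "0 \<le> A $$ (i, j)" if "i < n" "j < n" for i j
    using assms(2,3) that by (simp add: nonnegative_mat_def)
  have nonneg: "0 \<le> X $$ (i, j)" if "i < n" "j < n" for i j
    using A0[of i j] A0[of j i] that by (simp add: X_def less_eq_complex_def)
  have le: "complex_of_real (X $$ (i, j)) \<le> A $$ (i, j)" if "i < n" "j < n" for i j
    using A0[of i j] that by (simp add: X_def less_eq_complex_def)
  have "sym_min_mat n A = map_mat complex_of_real X"
    by (auto simp: sym_min_mat_def X_def)
  then have "loewner_ge n (complex_of_real (spectral_radius A) \<cdot>\<^sub>m 1\<^sub>m n) (sym_min_mat n A)"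
    using nonneg_symmetric_loewner_scalar[OF X sym nonneg
        symmetric_quadratic_form_le_spectral_radius[OF assms(2,1) X sym nonneg le]]
    by (simp only:)
  with assms(4-6) show ?thesis by (rule positive_unital_map_loewner_scalar)
qed

end
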